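(* Let $\Theta$ be a compact subset of a separable metric space, let $u\in\mathbb{N}$, and let $H:\Theta\times\mathbb{R}^u\to\mathbb{R}$ be a function such that (i) for each $x\in\mathbb{R}^u$, the map $\theta\mapsto H(\theta,x)$ is continuous on $\Theta$, and (ii) for each $\theta\in\Theta$, the map $x\mapsto H(\theta,x)$ is measurable on $\mathbb{R}^u$. Let $X_1,X_2,\ldots$ be i.i.d. random vectors in $\mathbb{R}^u$. For each $n\in\mathbb{N}$ let $m_n$ be a positive integer and let $$(W_{n1},\ldots,W_{nn})\sim\mathrm{Multinomial}\big(m_n,(1/n,\ldots,1/n)\big),$$ where the random vectors $(W_{n1},\ldots,W_{nn})$, $n\in\mathbb{N}$, are independent across $n$ and are independent of the sequence $(X_1,X_2,\ldots)$. Suppose there exists $\delta\in[0,1)$ such that $$\lim_{n\to\infty}\frac{n^{1-\delta}\log(n)}{m_n}=0\quad\text{and}\quad \mathbb{E}\Big(\sup_{\theta\in\Theta}|H(\theta,X_1)|^{\frac{1}{1-\delta}}\Big)<\infty.$$ Then $$\sup_{\theta\in\Theta}\bigg|\frac{1}{m_n}\sum_{j=1}^n W_{nj}H(\theta,X_j)-\mathbb{E}(H(\theta,X_1))\bigg|\longrightarrow 0\quad\text{almost surely as } n\to\infty.$$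
   Context: $\mathrm{Multinomial}(m,(p_1,\ldots,p_n))$ denotes the multinomial distribution of the vector of counts obtained from $m$ independent draws from $\{1,\ldots,n\}$ with probabilities $p_1,\ldots,p_n$. All random variables are defined on a common probability space. *)

theory Defs
  imports "HOL-Probability.Probability"
begin

text \<open>
  The law of the vector of counts \<open>(c\<^sub>i)\<^sub>i\<^sub>\<in>\<^sub>I\<close> of \<open>m\<close> independent draws from \<open>I\<close>, where
  the probabilities \<open>(p\<^sub>i)\<^sub>i\<^sub>\<in>\<^sub>I\<close> are given as a \<open>pmf\<close> (meant to be supported in \<open>I\<close>).
  Count vectors are extensional functions on \<open>I\<close>, i.e. points of the product space.
\<close>

definition multinomial :: "nat \<Rightarrow> 'i set \<Rightarrow> 'i pmf \<Rightarrow> ('i \<Rightarrow> nat) measure" where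
  "multinomial m I p =
     distr (measure_pmf (replicate_pmf m p)) (Pi\<^sub>M I (\<lambda>_. count_space UNIV))
       (\<lambda>xs. \<lambda>i\<in>I. count_list xs i)"

text \<open>
  Independence of two random variables whose value types may differ
  (\<open>indep_var\<close> forces both to have the same value type).
\<close>

definition (in prob_space) indep_var2 ::
  "'b measure \<Rightarrow> ('a \<Rightarrow> 'b) \<Rightarrow> 'c measure \<Rightarrow> ('a \<Rightarrow> 'c) \<Rightarrow> bool" where
  "indep_var2 S X T Y \<longleftrightarrow> random_variable S X \<and> random_variable T Y \<and>
     indep_set {X -` A \<inter> space M | A. A \<in> sets S} {Y -` B \<inter> space M | B. B \<in> sets T}"

end

theory Submission
  imports Defs
begin

text \<open>
  Given the observations, the resampled mean of a function \<open>f\<close> is the mean of \<open>m n\<close> independent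
  draws from the finite population \<open>f X\<^sub>1, \<dots>, f X\<^sub>n\<close>. It is compared with the mean of this
  population, and the latter tends to \<open>E (f X\<^sub>1)\<close> by the strong law of large numbers.

  The comparison rests on an exponential inequality (\<open>multinomial_mean_tail\<close>): a
  deviation \<open>\<epsilon>\<close> has probability at most \<open>2 exp (- c m n / B)\<close>, where \<open>B\<close> bounds the population in
  absolute value and \<open>c > 0\<close> depends only on \<open>\<epsilon>\<close> and a bound on the population mean of \<open>\<bar>f\<bar>\<close>.
  The strong law for \<open>\<bar>f\<bar>\<close> to the power \<open>1 / (1 - \<delta>)\<close> bounds each
  single term of the population: almost surely \<open>B\<close> may be taken of order \<open>n powr (1 - \<delta>)\<close>. Since
  \<open>m n\<close> outgrows \<open>n powr (1 - \<delta>) ln n\<close>, the probabilities are summable and the Borel-Cantelli lemma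
  gives almost sure convergence for one function \<open>f\<close> (\<open>resampled_mean_tendsto\<close>).

  Uniformity in \<open>\<theta>\<close> follows by a finite cover of \<open>\<Theta>\<close> on which the expected oscillation of \<open>H\<close> is
  small (\<open>resampled_mean_close_uniformly\<close>): the theorem for one function is applied
  to \<open>H\<close> at the centres of the cover and to the oscillations around them.

  The strong law for integrable variables is obtained from a maximal argument in the style of
  the ergodic theorem: if the mean is negative, then the partial sums are almost surely bounded
  above (\<open>max_sum_bounded_if_negative_mean\<close>).
\<close>

section \<open>The strong law of large numbers\<close>

text \<open>
  The maximum of the partial sums \<open>0, f x\<^sub>0, f x\<^sub>0 + f x\<^sub>1, \<dots>\<close> with at most \<open>n\<close> terms. The
  recursion peels off the first entry of \<open>x\<close>: it expresses the maximum for \<open>x\<close> through the one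
  for the shifted sequence, which is all that the law of large numbers below needs.
\<close>

primrec max_sum :: "('a \<Rightarrow> real) \<Rightarrow> nat \<Rightarrow> (nat \<Rightarrow> 'a) \<Rightarrow> real" where
  "max_sum f 0 x = 0"
| "max_sum f (Suc n) x = max 0 (f (x 0) + max_sum f n (\<lambda>i. x (Suc i)))"

lemma max_sum_nonneg: "0 \<le> max_sum f n x"
  by (cases n) auto

lemma incseq_max_sum: "incseq (\<lambda>n. max_sum f n x)"
proof (rule incseq_SucI)
  fix n show "max_sum f n x \<le> max_sum f (Suc n) x"
  proof (induction n arbitrary: x)
    case (Suc n)
    show ?case
      unfolding max_sum.simps(2)[of f "Suc n" x] max_sum.simps(2)[of f n x]
      by (intro max.mono add_left_mono Suc order_refl)
  qed simp
qed

lemma sum_le_max_sum: "(\<Sum>i<n. f (x i)) \<le> max_sum f n x"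
proof (induction n arbitrary: x)
  case (Suc n)
  from Suc[of "\<lambda>i. x (Suc i)"] show ?case
    by (simp add: sum.lessThan_Suc_shift del: sum.lessThan_Suc)
qed simp

context
  fixes D :: "'a measure" and f :: "'a \<Rightarrow> real"
  assumes D: "prob_space D" and f: "integrable D f"
begin

interpretation D: prob_space D by (rule D)

interpretation sequence_space D
  unfolding sequence_space_def by (rule product_prob_spaceI) (rule D)

interpretation PP: pair_prob_space D S ..

lemma measurable_max_sum: "max_sum f n \<in> borel_measurable S"
proof (induction n)
  case (Suc n)
  have [measurable]: "(\<lambda>x i. x (Suc i)) \<in> S \<rightarrow>\<^sub>M S"
    by (rule measurable_PiM_single') (auto simp: space_PiM)
  note [measurable] = Suc borel_measurable_integrable[OF f]
  show ?case by simp
qed simp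

text \<open>
  An i.i.d. sequence with an independent further entry put in front has the same law. This
  is the form in which stationarity and independence of the sequence are used.
\<close>

lemma integral_PiM_cons:
  fixes g :: "(nat \<Rightarrow> 'a) \<Rightarrow> real"
  assumes [measurable]: "g \<in> borel_measurable S"
  shows "(\<integral>x. g x \<partial>S) = (\<integral>(s, y). g (case_nat s y) \<partial>(D \<Otimes>\<^sub>M S))"
    and "integrable S g \<longleftrightarrow> integrable (D \<Otimes>\<^sub>M S) (\<lambda>(s, y). g (case_nat s y))"
proof -
  have [measurable]: "(\<lambda>(s, y). case_nat s y) \<in> D \<Otimes>\<^sub>M S \<rightarrow>\<^sub>M S" by measurable
  show "(\<integral>x. g x \<partial>S) = (\<integral>(s, y). g (case_nat s y) \<partial>(D \<Otimes>\<^sub>M S))"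
    by (subst PiM_iter[symmetric], subst integral_distr) (simp_all add: split_beta')
  show "integrable S g \<longleftrightarrow> integrable (D \<Otimes>\<^sub>M S) (\<lambda>(s, y). g (case_nat s y))"
    by (subst PiM_iter[symmetric], subst integrable_distr_eq) (simp_all add: split_beta')
qed

lemma integral_pair_mult:
  fixes g :: "'a \<Rightarrow> real" and h :: "(nat \<Rightarrow> 'a) \<Rightarrow> real"
  assumes "integrable D g" "integrable S h"
  shows "integrable (D \<Otimes>\<^sub>M S) (\<lambda>(s, y). g s * h y)"
    and "(\<integral>(s, y). g s * h y \<partial>(D \<Otimes>\<^sub>M S)) = (\<integral>s. g s \<partial>D) * (\<integral>y. h y \<partial>S)"
proof -
  note [measurable] = borel_measurable_integrable[OF assms(1)] borel_measurable_integrable[OF assms(2)]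
  show *: "integrable (D \<Otimes>\<^sub>M S) (\<lambda>(s, y). g s * h y)"
    using assms by (intro PP.Fubini_integrable) (auto simp: abs_mult)
  show "(\<integral>(s, y). g s * h y \<partial>(D \<Otimes>\<^sub>M S)) = (\<integral>s. g s \<partial>D) * (\<integral>y. h y \<partial>S)"
    using PP.integral_fst'[OF *] by simp
qed

lemma integrable_max_sum: "integrable S (max_sum f n)"
proof (induction n)
  case (Suc n)
  note [measurable] = borel_measurable_integrable[OF f] measurable_max_sum
  have 1: "integrable (D \<Otimes>\<^sub>M S) (\<lambda>(s, y). f s * 1)"
    using integral_pair_mult(1)[OF f, of "\<lambda>_. 1"] by simp
  have 2: "integrable (D \<Otimes>\<^sub>M S) (\<lambda>(s, y). 1 * max_sum f n y)"
    using integral_pair_mult(1)[OF _ Suc, of "\<lambda>_. 1"] by simp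
  have "integrable (D \<Otimes>\<^sub>M S) (\<lambda>z. max 0 ((case z of (s, y) \<Rightarrow> f s * 1) + (case z of (s, y) \<Rightarrow> 1 * max_sum f n y)))"
    by (intro integrable_max Bochner_Integration.integrable_add 1 2) simp
  then show ?case
    by (subst integral_PiM_cons) (simp_all add: split_beta')
qed simp

text \<open>
  Let \<open>a\<close> be the indicator of the event that the partial sums are unbounded above. It does not
  change when an entry \<open>s\<close> is put in front of \<open>y\<close>, and so it is independent of \<open>s\<close>. As the
  maxima grow with \<open>n\<close>,
  \<open>0 \<le> E [a \<cdot> (max_sum f (Suc n) (case_nat s y) - max_sum f n y)] = E [a \<cdot> max (f s) (- max_sum f n y)]\<close>.
  Where \<open>a = 1\<close> that maximum equals \<open>f s\<close> for large \<open>n\<close>, and it never exceeds \<open>\<bar>f s\<bar>\<close> in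
  absolute value. By dominated convergence \<open>0 \<le> E f \<cdot> E a\<close>, so that a negative mean of \<open>f\<close>
  forces \<open>E a = 0\<close>.
\<close>

lemma max_sum_bounded_if_negative_mean:
  assumes neg: "(\<integral>s. f s \<partial>D) < 0"
  shows "AE x in S. \<exists>C. \<forall>n. max_sum f n x \<le> C"
proof -
  note [measurable] = borel_measurable_integrable[OF f] measurable_max_sum
  define B where "B x \<longleftrightarrow> (\<exists>C::nat. \<forall>n. max_sum f n x \<le> real C)" for x
  have B_measurable [measurable]: "Measurable.pred S B"
    unfolding B_def by measurable
  define a :: "(nat \<Rightarrow> 'a) \<Rightarrow> real" where "a x = (if B x then 0 else 1)" for x
  have a_measurable [measurable]: "a \<in> borel_measurable S" unfolding a_def by measurable
  have int_bounded: "integrable S g \<Longrightarrow> integrable S (\<lambda>x. a x * g x)" for g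
    by (rule Bochner_Integration.integrable_bound[where f = g]) (auto simp: a_def)
  have B_unbounded: "filterlim (\<lambda>n. max_sum f n x) at_top sequentially" if "\<not> B x" for x
    unfolding filterlim_at_top eventually_sequentially
  proof
    fix Z :: real
    obtain C :: nat where "Z \<le> real C" using real_arch_simple by blast
    moreover obtain k where "real C < max_sum f k x"
      using \<open>\<not> B x\<close> unfolding B_def by (meson not_less)
    ultimately have "Z \<le> max_sum f n x" if "k \<le> n" for n
      using incseqD[OF incseq_max_sum that, of f x] by linarith
    then show "\<exists>N. \<forall>n\<ge>N. Z \<le> max_sum f n x" by blast
  qed
  have B_cons: "B (case_nat s y) \<longleftrightarrow> B y" for s y
  proof
    assume "B (case_nat s y)"
    then obtain C where C: "\<And>n. max_sum f n (case_nat s y) \<le> real C"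
      unfolding B_def by blast
    obtain C' :: nat where C': "real C - f s \<le> real C'" using real_arch_simple by blast
    have "max_sum f n y \<le> real C'" for n
      using C[of "Suc n"] C' by simp
    then show "B y" unfolding B_def by blast
  next
    assume "B y"
    then obtain C where C: "\<And>n. max_sum f n y \<le> real C"
      unfolding B_def by blast
    obtain C' :: nat where C': "\<bar>f s\<bar> + real C \<le> real C'" using real_arch_simple by blast
    have "max_sum f n (case_nat s y) \<le> real C'" for n
      using C[of "n - 1"] C' by (cases n) auto
    then show "B (case_nat s y)" unfolding B_def by blast
  qed
  have a_cons: "a (case_nat s y) = a y" for s y
    by (simp add: a_def B_cons)
  define h where "h n = (\<lambda>(s, y). a y * max (f s) (- max_sum f n y))" for n
  have int_a: "integrable S a"
    using int_bounded[of "\<lambda>_. 1"] by simp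
  note int_af = integral_pair_mult[OF f int_a]
  have h_lim: "(\<lambda>n. \<integral>z. h n z \<partial>(D \<Otimes>\<^sub>M S)) \<longlonglongrightarrow> (\<integral>(s, y). f s * a y \<partial>(D \<Otimes>\<^sub>M S))"
  proof (rule integral_dominated_convergence[where w = "\<lambda>(s, y). \<bar>f s\<bar> * 1"])
    show "integrable (D \<Otimes>\<^sub>M S) (\<lambda>(s, y). \<bar>f s\<bar> * 1)"
      using integral_pair_mult(1)[of "\<lambda>s. \<bar>f s\<bar>" "\<lambda>_. 1"] f by simp
    show "AE z in D \<Otimes>\<^sub>M S. (\<lambda>n. h n z) \<longlonglongrightarrow> (case z of (s, y) \<Rightarrow> f s * a y)"
    proof (rule AE_I2, clarify)
      fix s y
      show "(\<lambda>n. h n (s, y)) \<longlonglongrightarrow> f s * a y"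
      proof (cases "B y")
        case False
        then have "eventually (\<lambda>n. - f s \<le> max_sum f n y) sequentially"
          using B_unbounded[OF False] by (simp add: filterlim_at_top)
        then have "eventually (\<lambda>n. h n (s, y) = f s * a y) sequentially"
          by eventually_elim (auto simp: h_def a_def)
        then show ?thesis by (rule tendsto_eventually)
      qed (simp add: h_def a_def)
    qed
    show "AE z in D \<Otimes>\<^sub>M S. norm (h n z) \<le> (case z of (s, y) \<Rightarrow> \<bar>f s\<bar> * 1)" for n
      using max_sum_nonneg[of f n] by (intro AE_I2) (auto simp: h_def a_def max_def split: prod.split)
  qed (simp_all add: h_def split_beta')
  \<comment> \<open>Rewritten as a difference of two integrals, the first of which is the larger one: prepending
    \<open>s\<close> preserves the law while the maxima increase with their length.\<close>
  have h_nonneg: "0 \<le> (\<integral>z. h n z \<partial>(D \<Otimes>\<^sub>M S))" for n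
  proof -
    let ?u = "\<lambda>n x. a x * max_sum f n x"
    have int_u: "integrable S (?u n)" for n
      by (rule int_bounded[OF integrable_max_sum])
    have shift: "(\<integral>(s, y). 1 * ?u n y \<partial>(D \<Otimes>\<^sub>M S)) = (\<integral>y. ?u n y \<partial>S)"
      using integral_pair_mult(2)[OF _ int_u, of "\<lambda>_. 1"] by (simp add: D.prob_space)
    have int_shift: "integrable (D \<Otimes>\<^sub>M S) (\<lambda>(s, y). 1 * ?u n y)"
      using integral_pair_mult(1)[OF _ int_u, of "\<lambda>_. 1"] by simp
    have "(\<integral>y. ?u n y \<partial>S) \<le> (\<integral>x. ?u (Suc n) x \<partial>S)"
      using incseq_SucD[OF incseq_max_sum, of f] by (intro integral_mono int_u mult_left_mono) (simp_all add: a_def)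
    then have "0 \<le> (\<integral>(s, y). ?u (Suc n) (case_nat s y) \<partial>(D \<Otimes>\<^sub>M S)) - (\<integral>(s, y). 1 * ?u n y \<partial>(D \<Otimes>\<^sub>M S))"
      unfolding shift integral_PiM_cons(1)[OF borel_measurable_integrable[OF int_u], symmetric] by simp
    also have "\<dots> = (\<integral>z. (case z of (s, y) \<Rightarrow> ?u (Suc n) (case_nat s y)) - (case z of (s, y) \<Rightarrow> 1 * ?u n y) \<partial>(D \<Otimes>\<^sub>M S))"
      using int_u[of "Suc n"] integral_PiM_cons(2)[OF borel_measurable_integrable[OF int_u], of "Suc n"]
      by (intro Bochner_Integration.integral_diff[symmetric] int_shift) blast
    also have "\<dots> = (\<integral>z. h n z \<partial>(D \<Otimes>\<^sub>M S))"
      by (intro Bochner_Integration.integral_cong)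
         (auto simp: h_def a_cons algebra_simps max_def split: prod.split)
    finally show ?thesis .
  qed
  have "0 \<le> (\<integral>s. f s \<partial>D) * (\<integral>y. a y \<partial>S)"
    using LIMSEQ_le_const[OF h_lim] h_nonneg int_af(2) by auto
  then have "(\<integral>y. a y \<partial>S) \<le> 0"
    using neg by (simp add: zero_le_mult_iff)
  moreover have "0 \<le> (\<integral>y. a y \<partial>S)"
    by (intro integral_nonneg_AE) (simp add: a_def)
  ultimately have "(\<integral>y. a y \<partial>S) = 0" by simp
  then have "AE y in S. a y = 0"
    by (subst (asm) integral_nonneg_eq_0_iff_AE) (auto simp: int_a a_def)
  then show ?thesis
    by eventually_elim (auto simp: a_def B_def split: if_splits)
qed

end

text \<open>
  Subtracting slightly more than the mean from \<open>f\<close> makes the mean negative, so the partial sums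
  of \<open>f\<close> exceed that linear growth by a bounded amount only.
\<close>

lemma eventually_average_less:
  assumes D: "prob_space D" and f: "integrable D f" and "e > 0"
  shows "AE x in PiM UNIV (\<lambda>_::nat. D).
    eventually (\<lambda>n. (\<Sum>i<n. f (x i)) / real n < (\<integral>s. f s \<partial>D) + e) sequentially"
proof -
  interpret prob_space D by (rule D)
  let ?\<mu> = "\<integral>s. f s \<partial>D"
  define g where "g s = f s - (?\<mu> + e / 2)" for s
  have "integrable D g" unfolding g_def using f by simp
  moreover have "(\<integral>s. g s \<partial>D) < 0"
    unfolding g_def using f \<open>e > 0\<close> by (simp add: prob_space)
  ultimately have "AE x in PiM UNIV (\<lambda>_::nat. D). \<exists>C. \<forall>n. max_sum g n x \<le> C"
    by (rule max_sum_bounded_if_negative_mean[OF D])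
  then show ?thesis
  proof eventually_elim
    case (elim x)
    then obtain C where C: "\<And>n. max_sum g n x \<le> C" by blast
    obtain N :: nat where N: "2 * C / e < real N" using reals_Archimedean2 by blast
    have "(\<Sum>i<n. f (x i)) / real n < ?\<mu> + e" if "n > N" for n
    proof -
      have "n > 0" using that by simp
      have "(\<Sum>i<n. g (x i)) \<le> C" using sum_le_max_sum[of g x n] C[of n] by linarith
      then have "(\<Sum>i<n. f (x i)) \<le> real n * (?\<mu> + e / 2) + C"
        by (simp add: g_def sum_subtractf)
      moreover have "C < real n * (e / 2)"
      proof -
        have "2 * C / e < real n" using N that by linarith
        then show ?thesis using \<open>e > 0\<close> by (simp add: pos_divide_less_eq)
      qed
      ultimately show ?thesis using \<open>n > 0\<close> by (simp add: field_simps)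
    qed
    then show ?case unfolding eventually_sequentially by (meson Suc_le_lessD)
  qed
qed

proposition strong_law_of_large_numbers:
  fixes f :: "'a \<Rightarrow> real"
  assumes D: "prob_space D" and f: "integrable D f"
  shows "AE x in PiM UNIV (\<lambda>_::nat. D). (\<lambda>n. (\<Sum>i<n. f (x i)) / real n) \<longlonglongrightarrow> (\<integral>s. f s \<partial>D)"
proof -
  let ?\<mu> = "\<integral>s. f s \<partial>D"
  have "AE x in PiM UNIV (\<lambda>_::nat. D). \<forall>k. eventually (\<lambda>n. (\<Sum>i<n. f (x i)) / real n < ?\<mu> + inverse (Suc k)) sequentially"
    unfolding AE_all_countable by (intro allI eventually_average_less D f) simp
  moreover have "AE x in PiM UNIV (\<lambda>_::nat. D). \<forall>k. eventually (\<lambda>n. (\<Sum>i<n. - f (x i)) / real n < (\<integral>s. - f s \<partial>D) + inverse (Suc k)) sequentially"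
    unfolding AE_all_countable using f by (intro allI eventually_average_less D) auto
  ultimately show ?thesis
  proof eventually_elim
    case (elim x)
    show ?case
    proof (rule tendstoI)
      fix e :: real assume "e > 0"
      then obtain k where "inverse (Suc k) < e" using reals_Archimedean by blast
      from elim(1)[rule_format, of k] elim(2)[rule_format, of k]
      show "eventually (\<lambda>n. dist ((\<Sum>i<n. f (x i)) / real n) ?\<mu> < e) sequentially"
        by eventually_elim (use \<open>inverse (Suc k) < e\<close> in \<open>auto simp: dist_real_def sum_negf abs_less_iff\<close>)
    qed
  qed
qed

section \<open>Exponential inequalities for multinomial counts\<close>

lemma exp_le_quadratic:
  fixes x :: real
  assumes "\<bar>x\<bar> \<le> 1"
  shows "exp x \<le> 1 + x + x\<^sup>2"
proof (cases "0 \<le> x")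
  case True
  then show ?thesis using assms exp_bound by simp
next
  case False
  define y where "y = - x"
  have y: "0 \<le> y" "y \<le> 1" using False assms by (auto simp: y_def)
  have "1 \<le> (1 - y + y\<^sup>2) * (1 + y + y\<^sup>2 / 2)"
  proof -
    have "(1 - y + y\<^sup>2) * (1 + y + y\<^sup>2 / 2) = 1 + y\<^sup>2 / 2 + y ^ 3 / 2 + y ^ 4 / 2"
      by (simp add: field_simps power2_eq_square power3_eq_cube power4_eq_xxxx)
    then show ?thesis using y by simp
  qed
  also have "\<dots> \<le> (1 - y + y\<^sup>2) * exp y"
    using y exp_lower_Taylor_quadratic[of y] by (intro mult_left_mono) auto
  finally show ?thesis
    by (simp add: y_def exp_minus field_simps)
qed

text \<open>
  The draws are independent, so the moment generating function of their sum is a power.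
\<close>

lemma nn_integral_exp_sum_list_replicate_pmf:
  "(\<integral>\<^sup>+ xs. ennreal (exp (s * sum_list (map z xs))) \<partial>replicate_pmf m p)
     = (\<integral>\<^sup>+ x. ennreal (exp (s * z x)) \<partial>measure_pmf p) ^ m"
proof (induction m)
  case (Suc m)
  then show ?case
    by (simp add: distrib_left exp_add ennreal_mult nn_integral_cmult nn_integral_multc)
qed simp

text \<open>
  A bound of Bernstein type, by Chernoff's method. For \<open>s B \<le> 1\<close> the quadratic bound on \<open>exp\<close>,
  with \<open>z\<^sup>2 \<le> B \<bar>z\<bar>\<close>, shows that \<open>s z\<close> has exponential moment at most \<open>exp (s \<mu> + s\<^sup>2 B A)\<close>. What
  matters is that the variance enters through the first absolute moment \<open>A\<close>: then the rate is
  \<open>m / B\<close> up to a constant depending on \<open>\<epsilon>\<close> and \<open>A\<close>, whereas a bound in terms of \<open>B\<close> alone would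
  only give \<open>m / B\<^sup>2\<close>.
\<close>

lemma replicate_pmf_sum_upper_tail:
  fixes z :: "'a \<Rightarrow> real"
  assumes B: "\<And>x. x \<in> set_pmf p \<Longrightarrow> \<bar>z x\<bar> \<le> B" and "B > 0"
    and A: "measure_pmf.expectation p (\<lambda>x. \<bar>z x\<bar>) \<le> A" and "A > 0"
    and "\<epsilon> > 0"
  shows "measure_pmf.prob (replicate_pmf m p)
           {xs. sum_list (map z xs) \<ge> real m * (measure_pmf.expectation p z + \<epsilon>)}
         \<le> exp (- (\<epsilon> * min 1 (\<epsilon> / (2 * A)) / 2) * (real m / B))"
proof -
  let ?\<mu> = "measure_pmf.expectation p z" and ?a = "real m * (measure_pmf.expectation p z + \<epsilon>)"
  \<comment> \<open>The largest \<open>s\<close> for which the quadratic bound applies and the variance term \<open>s\<^sup>2 B A\<close> takes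
    at most half of the gain \<open>s \<epsilon>\<close>.\<close>
  define s where "s = min 1 (\<epsilon> / (2 * A)) / B"
  have s: "s > 0" "s * B \<le> 1" "s * B * A \<le> \<epsilon> / 2"
    using assms by (auto simp: s_def min_def field_simps)
  have int_z: "integrable p z"
    using B by (intro measure_pmf.integrable_const_bound[where B = B]) (auto simp: AE_measure_pmf_iff)
  have "(\<integral>\<^sup>+ x. ennreal (exp (s * z x)) \<partial>p) \<le> (\<integral>\<^sup>+ x. ennreal (1 + s * z x + s\<^sup>2 * B * \<bar>z x\<bar>) \<partial>p)"
  proof (rule nn_integral_mono_AE, unfold AE_measure_pmf_iff, intro ballI ennreal_leI)
    fix x assume x: "x \<in> set_pmf p"
    have *: "\<bar>s * z x\<bar> \<le> s * B" using B[OF x] s by (simp add: abs_mult)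
    then have "exp (s * z x) \<le> 1 + s * z x + (s * z x)\<^sup>2"
      using s by (intro exp_le_quadratic) linarith
    also have "(s * z x)\<^sup>2 = s\<^sup>2 * (\<bar>z x\<bar> * \<bar>z x\<bar>)" by (simp add: power2_eq_square)
    also have "\<dots> \<le> s\<^sup>2 * (B * \<bar>z x\<bar>)" using B[OF x] by (intro mult_left_mono mult_right_mono) auto
    finally show "exp (s * z x) \<le> 1 + s * z x + s\<^sup>2 * B * \<bar>z x\<bar>" by (simp add: mult.assoc)
  qed
  also have "\<dots> = ennreal (measure_pmf.expectation p (\<lambda>x. 1 + s * z x + s\<^sup>2 * B * \<bar>z x\<bar>))"
  proof (rule nn_integral_eq_integral)
    show "AE x in p. 0 \<le> 1 + s * z x + s\<^sup>2 * B * \<bar>z x\<bar>"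
    proof (unfold AE_measure_pmf_iff, intro ballI)
      fix x assume x: "x \<in> set_pmf p"
      have "\<bar>s * z x\<bar> \<le> s * B" using B[OF x] s by (simp add: abs_mult)
      then have "0 \<le> 1 + s * z x" using s by linarith
      then show "0 \<le> 1 + s * z x + s\<^sup>2 * B * \<bar>z x\<bar>" using \<open>B > 0\<close> by simp
    qed
  qed (use int_z in auto)
  also have "measure_pmf.expectation p (\<lambda>x. 1 + s * z x + s\<^sup>2 * B * \<bar>z x\<bar>)
      = 1 + s * ?\<mu> + s\<^sup>2 * B * measure_pmf.expectation p (\<lambda>x. \<bar>z x\<bar>)"
    using int_z by simp
  also have "\<dots> \<le> 1 + (s * ?\<mu> + s\<^sup>2 * B * A)"
    using A \<open>B > 0\<close> by (simp add: mult_left_mono)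
  also have "\<dots> \<le> exp (s * ?\<mu> + s\<^sup>2 * B * A)"
    by (rule exp_ge_add_one_self)
  finally have mgf: "(\<integral>\<^sup>+ x. ennreal (exp (s * z x)) \<partial>p) \<le> ennreal (exp (s * ?\<mu> + s\<^sup>2 * B * A))"
    by (simp add: ennreal_leI)
  have "emeasure (replicate_pmf m p) {xs. sum_list (map z xs) \<ge> ?a}
      \<le> ennreal (exp (- s * ?a)) * (\<integral>\<^sup>+ xs. ennreal (exp (s * sum_list (map z xs))) \<partial>replicate_pmf m p)"
    using Chernoff_ineq_nn_integral_ge[OF s(1), of UNIV "replicate_pmf m p" "\<lambda>xs. sum_list (map z xs)" ?a]
    by simp
  also have "\<dots> \<le> ennreal (exp (- s * ?a)) * ennreal (exp (s * ?\<mu> + s\<^sup>2 * B * A)) ^ m"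
    unfolding nn_integral_exp_sum_list_replicate_pmf by (intro mult_left_mono power_mono mgf) auto
  also have "\<dots> = ennreal (exp (- s * ?a + real m * (s * ?\<mu> + s\<^sup>2 * B * A)))"
    by (simp only: ennreal_power ennreal_mult[symmetric] exp_ge_zero exp_of_nat_mult[symmetric] exp_add[symmetric])
  finally have "measure_pmf.prob (replicate_pmf m p) {xs. sum_list (map z xs) \<ge> ?a}
      \<le> exp (- s * ?a + real m * (s * ?\<mu> + s\<^sup>2 * B * A))"
    by (simp add: measure_pmf.emeasure_eq_measure)
  also have "- s * ?a + real m * (s * ?\<mu> + s\<^sup>2 * B * A) = real m * s * (s * B * A - \<epsilon>)"
    by (simp add: algebra_simps power2_eq_square)
  also have "real m * s * (s * B * A - \<epsilon>) \<le> real m * s * (- (\<epsilon> / 2))"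
    using s by (intro mult_left_mono) auto
  also have "real m * s * (- (\<epsilon> / 2)) = - (\<epsilon> * min 1 (\<epsilon> / (2 * A)) / 2) * (real m / B)"
    by (simp add: s_def ac_simps)
  finally show ?thesis by simp
qed

lemma replicate_pmf_mean_tail:
  fixes z :: "'a \<Rightarrow> real"
  assumes B: "\<And>x. x \<in> set_pmf p \<Longrightarrow> \<bar>z x\<bar> \<le> B" and "B > 0"
    and A: "measure_pmf.expectation p (\<lambda>x. \<bar>z x\<bar>) \<le> A" and "A > 0"
    and "\<epsilon> > 0" "m > 0"
  shows "measure_pmf.prob (replicate_pmf m p)
           {xs. \<epsilon> \<le> \<bar>sum_list (map z xs) / real m - measure_pmf.expectation p z\<bar>}
         \<le> 2 * exp (- (\<epsilon> * min 1 (\<epsilon> / (2 * A)) / 2) * (real m / B))"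
proof -
  let ?\<mu> = "measure_pmf.expectation p z"
  let ?U = "{xs. sum_list (map z xs) \<ge> real m * (?\<mu> + \<epsilon>)}"
  let ?L = "{xs. sum_list (map (\<lambda>x. - z x) xs) \<ge> real m * (measure_pmf.expectation p (\<lambda>x. - z x) + \<epsilon>)}"
  have neg: "sum_list (map (\<lambda>x. - z x) xs) = - sum_list (map z xs)" for xs
    by (induction xs) auto
  have "{xs. \<epsilon> \<le> \<bar>sum_list (map z xs) / real m - ?\<mu>\<bar>} \<subseteq> ?U \<union> ?L"
  proof
    fix xs assume "xs \<in> {xs. \<epsilon> \<le> \<bar>sum_list (map z xs) / real m - ?\<mu>\<bar>}"
    then have "?\<mu> + \<epsilon> \<le> sum_list (map z xs) / real m \<or> sum_list (map z xs) / real m \<le> ?\<mu> - \<epsilon>"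
      by auto
    then have "real m * (?\<mu> + \<epsilon>) \<le> sum_list (map z xs) \<or> sum_list (map z xs) \<le> real m * (?\<mu> - \<epsilon>)"
      using \<open>m > 0\<close> by (simp add: pos_le_divide_eq pos_divide_le_eq mult.commute)
    then show "xs \<in> ?U \<union> ?L"
      by (auto simp: neg right_diff_distrib distrib_left)
  qed
  then have "measure_pmf.prob (replicate_pmf m p) {xs. \<epsilon> \<le> \<bar>sum_list (map z xs) / real m - ?\<mu>\<bar>}
      \<le> measure_pmf.prob (replicate_pmf m p) (?U \<union> ?L)"
    by (intro measure_pmf.finite_measure_mono) auto
  also have "\<dots> \<le> measure_pmf.prob (replicate_pmf m p) ?U + measure_pmf.prob (replicate_pmf m p) ?L"
    by (rule measure_Un_le) auto
  also have "\<dots> \<le> 2 * exp (- (\<epsilon> * min 1 (\<epsilon> / (2 * A)) / 2) * (real m / B))"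
    using replicate_pmf_sum_upper_tail[of p z B A \<epsilon> m] replicate_pmf_sum_upper_tail[of p "\<lambda>x. - z x" B A \<epsilon> m] assms
    by simp
  finally show ?thesis .
qed

lemma sum_count_list_eq_sum_list:
  fixes z :: "'i \<Rightarrow> real"
  assumes "finite I" "set xs \<subseteq> I"
  shows "(\<Sum>i\<in>I. real (count_list xs i) * z i) = sum_list (map z xs)"
  using assms(2)
proof (induction xs)
  case (Cons x xs)
  have "(\<Sum>i\<in>I. real (count_list (x # xs) i) * z i) = (\<Sum>i\<in>I. real (count_list xs i) * z i + (if i = x then z i else 0))"
    by (intro sum.cong) (auto simp: algebra_simps)
  then show ?case using Cons assms(1) by (simp add: sum.distrib sum.delta')
qed simp

text \<open>
  Weighting \<open>z\<close> with multinomial counts is the same as averaging \<open>z\<close> over the draws.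
\<close>

lemma multinomial_mean_tail:
  fixes z :: "'i \<Rightarrow> real"
  assumes fin: "finite I" and supp: "set_pmf p \<subseteq> I"
    and B: "\<And>i. i \<in> I \<Longrightarrow> \<bar>z i\<bar> \<le> B" and "B > 0"
    and A: "measure_pmf.expectation p (\<lambda>i. \<bar>z i\<bar>) \<le> A" and "A > 0"
    and "\<epsilon> > 0" "m > 0"
  shows "measure (multinomial m I p)
           {c \<in> space (Pi\<^sub>M I (\<lambda>_. count_space UNIV)).
              \<epsilon> \<le> \<bar>(\<Sum>i\<in>I. real (c i) * z i) / real m - measure_pmf.expectation p z\<bar>}
         \<le> 2 * exp (- (\<epsilon> * min 1 (\<epsilon> / (2 * A)) / 2) * (real m / B))"
proof -
  let ?P = "Pi\<^sub>M I (\<lambda>_. count_space UNIV) :: ('i \<Rightarrow> nat) measure"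
  let ?E = "{c \<in> space ?P. \<epsilon> \<le> \<bar>(\<Sum>i\<in>I. real (c i) * z i) / real m - measure_pmf.expectation p z\<bar>}"
  have E: "?E \<in> sets ?P" by measurable
  have "measure (multinomial m I p) ?E
      = measure_pmf.prob (replicate_pmf m p) ((\<lambda>xs. \<lambda>i\<in>I. count_list xs i) -` ?E)"
    unfolding multinomial_def using measure_distr[OF _ E, of "\<lambda>xs. \<lambda>i\<in>I. count_list xs i" "replicate_pmf m p"]
    by (simp add: space_PiM)
  also have "\<dots> = measure_pmf.prob (replicate_pmf m p)
           {xs. \<epsilon> \<le> \<bar>sum_list (map z xs) / real m - measure_pmf.expectation p z\<bar>}"
  proof (rule measure_pmf.finite_measure_eq_AE, unfold AE_measure_pmf_iff, intro ballI)
    fix xs assume "xs \<in> set_pmf (replicate_pmf m p)"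
    then have "set xs \<subseteq> I" using supp by (auto simp: set_replicate_pmf)
    from sum_count_list_eq_sum_list[OF fin this, of z]
    show "xs \<in> (\<lambda>xs. \<lambda>i\<in>I. count_list xs i) -` ?E \<longleftrightarrow>
        xs \<in> {xs. \<epsilon> \<le> \<bar>sum_list (map z xs) / real m - measure_pmf.expectation p z\<bar>}"
      by (simp add: space_PiM)
  qed auto
  also have "\<dots> \<le> 2 * exp (- (\<epsilon> * min 1 (\<epsilon> / (2 * A)) / 2) * (real m / B))"
    using assms by (intro replicate_pmf_mean_tail) auto
  finally show ?thesis .
qed

section \<open>Conditioning on an independent variable\<close>

lemma (in prob_space) distr_pair_indep_var2:
  assumes "indep_var2 S X T Y"
  shows "distr M S X \<Otimes>\<^sub>M distr M T Y = distr M (S \<Otimes>\<^sub>M T) (\<lambda>\<omega>. (X \<omega>, Y \<omega>))"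
proof (rule pair_measure_eqI)
  have X [measurable]: "random_variable S X" and Y [measurable]: "random_variable T Y"
    and indep: "indep_set {X -` A \<inter> space M | A. A \<in> sets S} {Y -` B \<inter> space M | B. B \<in> sets T}"
    using assms unfolding indep_var2_def by auto
  show "sigma_finite_measure (distr M S X)" "sigma_finite_measure (distr M T Y)"
    using prob_space_distr[OF X] prob_space_distr[OF Y]
    by (simp_all add: prob_space.axioms finite_measure.axioms)
  fix A B assume "A \<in> sets (distr M S X)" "B \<in> sets (distr M T Y)"
  then have A [measurable]: "A \<in> sets S" and B [measurable]: "B \<in> sets T" by auto
  have "prob ((X -` A \<inter> space M) \<inter> (Y -` B \<inter> space M)) = prob (X -` A \<inter> space M) * prob (Y -` B \<inter> space M)"
    by (rule indep_setD[OF indep]) (use A B in auto)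
  moreover have "(\<lambda>\<omega>. (X \<omega>, Y \<omega>)) -` (A \<times> B) \<inter> space M = (X -` A \<inter> space M) \<inter> (Y -` B \<inter> space M)"
    by auto
  ultimately show "emeasure (distr M S X) A * emeasure (distr M T Y) B
      = emeasure (distr M (S \<Otimes>\<^sub>M T) (\<lambda>\<omega>. (X \<omega>, Y \<omega>))) (A \<times> B)"
    by (simp add: emeasure_distr emeasure_eq_measure ennreal_mult)
qed simp

text \<open>
  Fubini's theorem as conditioning: a property of independent \<open>X\<close> and \<open>Y\<close> may be checked with
  the value of \<open>X\<close> held fixed.
\<close>

lemma (in prob_space) AE_indep_var2I:
  assumes indep: "indep_var2 S X T Y"
    and Q [measurable]: "Measurable.pred (S \<Otimes>\<^sub>M T) (\<lambda>(x, y). Q x y)"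
    and AE: "AE x in distr M S X. AE \<omega> in M. Q x (Y \<omega>)"
  shows "AE \<omega> in M. Q (X \<omega>) (Y \<omega>)"
proof -
  have X [measurable]: "random_variable S X" and Y [measurable]: "random_variable T Y"
    using indep unfolding indep_var2_def by auto
  interpret X: prob_space "distr M S X" by (rule prob_space_distr[OF X])
  interpret Y: prob_space "distr M T Y" by (rule prob_space_distr[OF Y])
  interpret XY: pair_prob_space "distr M S X" "distr M T Y" ..
  have "AE x in distr M S X. AE y in distr M T Y. Q x y"
    using AE AE_space
  proof eventually_elim
    case (elim x)
    then have [measurable]: "x \<in> space S" by simp
    have "Measurable.pred T (\<lambda>y. Q x y)"
      using measurable_compose[OF measurable_Pair1', OF _ Q, of x] by simp
    then show ?case using elim(1) by (subst AE_distr_iff) auto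
  qed
  then have "AE z in distr M S X \<Otimes>\<^sub>M distr M T Y. case z of (x, y) \<Rightarrow> Q x y"
    using Q by (intro XY.AE_pair_measure) (simp_all add: pred_def space_pair_measure)
  then show ?thesis
    unfolding distr_pair_indep_var2[OF indep] by (subst (asm) AE_distr_iff) auto
qed

section \<open>Resampling a fixed sequence\<close>

lemma abs_le_one_plus_powr:
  fixes y p :: real
  assumes "1 \<le> p"
  shows "\<bar>y\<bar> \<le> 1 + \<bar>y\<bar> powr p"
proof (cases "\<bar>y\<bar> \<le> 1")
  case True then show ?thesis by (intro order_trans[OF True]) simp
next
  case False
  then have "\<bar>y\<bar> powr 1 \<le> \<bar>y\<bar> powr p" using assms by (intro powr_mono) auto
  then show ?thesis using False by simp
qed

text \<open>
  The weighted mean for a fixed sequence \<open>z\<close> is the mean of \<open>m n\<close> draws from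
  \<open>z\<^sub>1, \<dots>, z\<^sub>n\<close>, whose expectation \<open>\<mu> n\<close> tends to \<open>c\<close>. The bound on the averages of \<open>\<bar>z i\<bar> powr p\<close>,
  where \<open>p = 1 / (1 - \<delta>)\<close>, limits a single summand, so \<open>\<bar>z i\<bar>\<close> is of order \<open>n powr (1 - \<delta>)\<close> for \<open>i \<le> n\<close>, and
  it also bounds the averages of \<open>\<bar>z i\<bar>\<close>. Hence the probability of a deviation \<open>\<epsilon>\<close> is at most
  \<open>2 exp (- c' m n / n powr (1 - \<delta>))\<close> for some \<open>c' > 0\<close>. By the growth condition on \<open>m\<close>, the exponent
  eventually dominates \<open>2 ln n\<close>, so these probabilities are summable and the Borel-Cantelli lemma
  applies.
\<close>

lemma (in prob_space) multinomial_weighted_mean_tendsto: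
  fixes W :: "nat \<Rightarrow> nat \<Rightarrow> 'a \<Rightarrow> nat" and m :: "nat \<Rightarrow> nat" and z :: "nat \<Rightarrow> real"
  assumes W: "\<And>n. n \<ge> 1 \<Longrightarrow>
        random_variable (Pi\<^sub>M {1..n} (\<lambda>_. count_space UNIV)) (\<lambda>\<omega>. \<lambda>j\<in>{1..n}. W n j \<omega>)"
    and law: "\<And>n. n \<ge> 1 \<Longrightarrow>
        distr M (Pi\<^sub>M {1..n} (\<lambda>_. count_space UNIV)) (\<lambda>\<omega>. \<lambda>j\<in>{1..n}. W n j \<omega>)
          = multinomial (m n) {1..n} (pmf_of_set {1..n})"
    and m: "\<And>n. n \<ge> 1 \<Longrightarrow> m n > 0"
    and \<delta>: "0 \<le> \<delta>" "\<delta> < 1"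
    and rate: "(\<lambda>n. real n powr (1 - \<delta>) * ln (real n) / real (m n)) \<longlonglongrightarrow> 0"
    and mean: "(\<lambda>n. (\<Sum>i=1..n. z i) / real n) \<longlonglongrightarrow> c"
    and moment: "\<And>n. n \<ge> 1 \<Longrightarrow> (\<Sum>i=1..n. \<bar>z i\<bar> powr (1 / (1 - \<delta>))) / real n \<le> A"
  shows "AE \<omega> in M. (\<lambda>n. (\<Sum>j=1..n. real (W n j \<omega>) * z j) / real (m n)) \<longlonglongrightarrow> c"
proof -
  let ?P = "\<lambda>n. Pi\<^sub>M {1..n} (\<lambda>_. count_space UNIV) :: (nat \<Rightarrow> nat) measure"
  define T where "T n \<omega> = (\<Sum>j=1..n. real (W n j \<omega>) * z j) / real (m n)" for n \<omega>
  define \<mu> where "\<mu> n = (\<Sum>i=1..n. z i) / real n" for n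
  \<comment> \<open>At least 1, which makes \<open>A'\<close> a bound for its own power \<open>A' powr (1 - \<delta>)\<close>.\<close>
  define A' where "A' = max 1 A"
  have A': "A' \<ge> 1" "A \<le> A'" by (auto simp: A'_def)
  define p where "p = 1 / (1 - \<delta>)"
  have p: "p \<ge> 1" "p * (1 - \<delta>) = 1" using \<delta> by (auto simp: p_def)
  have moment': "(\<Sum>i=1..n. \<bar>z i\<bar> powr p) \<le> A' * real n" if "n \<ge> 1" for n
    using moment[OF that] A' that unfolding p_def[symmetric]
    by (simp add: pos_divide_le_eq) (meson mult_right_mono of_nat_0_le_iff order_trans)
  have z_bound: "\<bar>z j\<bar> \<le> A' * real n powr (1 - \<delta>)" if "j \<in> {1..n}" for n j
  proof -
    have "n \<ge> 1" using that by auto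
    have "\<bar>z j\<bar> powr p \<le> (\<Sum>i=1..n. \<bar>z i\<bar> powr p)"
      using that by (intro member_le_sum) auto
    also have "\<dots> \<le> A' * real n" by (rule moment') fact
    finally have "(\<bar>z j\<bar> powr p) powr (1 - \<delta>) \<le> (A' * real n) powr (1 - \<delta>)"
      using \<delta> by (intro powr_mono2) auto
    also have "(\<bar>z j\<bar> powr p) powr (1 - \<delta>) = \<bar>z j\<bar>"
      by (simp add: powr_powr p)
    also have "(A' * real n) powr (1 - \<delta>) = A' powr (1 - \<delta>) * real n powr (1 - \<delta>)"
      using A' by (simp add: powr_mult)
    also have "A' powr (1 - \<delta>) \<le> A' powr 1"
      using A' \<delta> by (intro powr_mono) auto
    finally show ?thesis using A' by (simp add: mult_right_mono)
  qed
  have z_mean: "(\<Sum>i=1..n. \<bar>z i\<bar>) / real n \<le> 1 + A'" if "n \<ge> 1" for n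
  proof -
    have "(\<Sum>i=1..n. \<bar>z i\<bar>) \<le> (\<Sum>i=1..n. 1 + \<bar>z i\<bar> powr p)"
      by (intro sum_mono abs_le_one_plus_powr p(1))
    also have "\<dots> \<le> real n + A' * real n" using moment'[OF that] by (simp add: sum.distrib)
    finally show ?thesis using that by (simp add: field_simps)
  qed
  have W_comp [measurable]: "W n j \<in> M \<rightarrow>\<^sub>M count_space UNIV" if "j \<in> {1..n}" for n j
    using measurable_compose[OF W measurable_component_singleton, of n j] that by simp
  have T_meas [measurable]: "T n \<in> borel_measurable M" for n
    unfolding T_def by measurable
  define E where "E \<epsilon> n = {\<omega> \<in> space M. \<epsilon> \<le> \<bar>T n \<omega> - \<mu> n\<bar>}" for \<epsilon> n
  have E_sets [measurable]: "E \<epsilon> n \<in> events" for \<epsilon> n unfolding E_def by measurable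
  have eventually_close: "AE \<omega> in M. eventually (\<lambda>n. \<bar>T n \<omega> - \<mu> n\<bar> < \<epsilon>) sequentially" if "\<epsilon> > 0" for \<epsilon>
  proof -
    define \<kappa> where "\<kappa> = \<epsilon> * min 1 (\<epsilon> / (2 * (1 + A'))) / 2"
    have "\<kappa> > 0" using \<open>\<epsilon> > 0\<close> A' by (auto simp: \<kappa>_def)
    have tail: "prob (E \<epsilon> n) \<le> 2 * exp (- \<kappa> * (real (m n) / (A' * real n powr (1 - \<delta>))))" if "n \<ge> 1" for n
    proof -
      let ?F = "{c \<in> space (?P n). \<epsilon> \<le> \<bar>(\<Sum>i=1..n. real (c i) * z i) / real (m n)
                   - measure_pmf.expectation (pmf_of_set {1..n}) z\<bar>}"
      have F: "?F \<in> sets (?P n)" by measurable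
      have exps: "measure_pmf.expectation (pmf_of_set {1..n}) h = (\<Sum>i=1..n. h i) / real n" for h :: "nat \<Rightarrow> real"
        using that by (simp add: integral_pmf_of_set)
      have "measure (multinomial (m n) {1..n} (pmf_of_set {1..n})) ?F \<le> 2 * exp (- \<kappa> * (real (m n) / (A' * real n powr (1 - \<delta>))))"
        unfolding \<kappa>_def
        by (rule multinomial_mean_tail) (use that m A' \<open>\<epsilon> > 0\<close> z_bound z_mean in \<open>auto simp: exps simp del: One_nat_def\<close>)
      also have "measure (multinomial (m n) {1..n} (pmf_of_set {1..n})) ?F = prob (E \<epsilon> n)"
        unfolding law[OF that, symmetric] measure_distr[OF W[OF that] F]
        by (intro arg_cong[where f = prob]) (auto simp: E_def T_def \<mu>_def exps space_PiM simp del: One_nat_def)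
      finally show ?thesis .
    qed
    have "eventually (\<lambda>n. real n powr (1 - \<delta>) * ln (real n) / real (m n) < \<kappa> / (2 * A')) sequentially"
      using order_tendstoD(2)[OF rate, of "\<kappa> / (2 * A')"] \<open>\<kappa> > 0\<close> A' by simp
    then have "eventually (\<lambda>n. norm (prob (E \<epsilon> n)) \<le> 2 * (1 / real n ^ 2)) sequentially"
      using eventually_ge_at_top[of 1]
    proof eventually_elim
      case (elim n)
      have n: "real n > 0" "real (m n) > 0" "real n powr (1 - \<delta>) > 0" using elim m[of n] by auto
      have "2 * ln (real n) \<le> \<kappa> * (real (m n) / (A' * real n powr (1 - \<delta>)))"
        using elim(1) n A' by (simp add: field_simps)
      then have "exp (- \<kappa> * (real (m n) / (A' * real n powr (1 - \<delta>)))) \<le> exp (- (2 * ln (real n)))"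
        by simp
      also have "\<dots> = 1 / real n ^ 2"
        using n exp_of_nat_mult[of 2 "ln (real n)"] by (simp add: exp_minus inverse_eq_divide)
      finally show ?case using tail[OF elim(2)] by simp
    qed
    moreover have "summable (\<lambda>n. 2 * (1 / real n ^ 2))"
      using inverse_power_summable[of 2, where 'a = real] by (intro summable_mult) (simp add: inverse_eq_divide)
    ultimately have "summable (\<lambda>n. prob (E \<epsilon> n))"
      by (rule summable_comparison_test_ev)
    then have "AE \<omega> in M. eventually (\<lambda>n. \<omega> \<in> space M - E \<epsilon> n) sequentially"
      by (intro borel_cantelli_AE1) (auto simp: emeasure_eq_measure)
    then show ?thesis
    proof eventually_elim
      case (elim \<omega>)
      then show ?case by eventually_elim (auto simp: E_def)
    qed
  qed
  have "AE \<omega> in M. \<forall>k. eventually (\<lambda>n. \<bar>T n \<omega> - \<mu> n\<bar> < inverse (real (Suc k))) sequentially"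
    unfolding AE_all_countable by (intro allI eventually_close) simp
  then have "AE \<omega> in M. (\<lambda>n. T n \<omega>) \<longlonglongrightarrow> c"
  proof eventually_elim
    case (elim \<omega>)
    have "(\<lambda>n. T n \<omega> - \<mu> n) \<longlonglongrightarrow> 0"
    proof (rule tendstoI)
      fix e :: real assume "e > 0"
      then obtain k where "inverse (real (Suc k)) < e" using reals_Archimedean by blast
      then show "eventually (\<lambda>n. dist (T n \<omega> - \<mu> n) 0 < e) sequentially"
        using elim[rule_format, of k] by (auto elim!: eventually_mono)
    qed
    from tendsto_add[OF this mean[folded \<mu>_def]] show ?case by simp
  qed
  then show ?thesis unfolding T_def .
qed

section \<open>Resampling an i.i.d. sample\<close>

text \<open>
  The strong law, transported from the canonical sequence space to random variables whose
  indices start at 1.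
\<close>

lemma (in prob_space) iid_mean_tendsto:
  fixes f :: "'b \<Rightarrow> real"
  assumes indep: "indep_vars (\<lambda>_. N) X {1::nat..}"
    and ident: "\<And>j. j \<ge> 1 \<Longrightarrow> distr M N (X j) = D"
    and f: "integrable D f"
  shows "AE \<omega> in M. (\<lambda>n. (\<Sum>j=1..n. f (X j \<omega>)) / real n) \<longlonglongrightarrow> (\<integral>x. f x \<partial>D)"
proof -
  have X [measurable]: "random_variable N (X j)" if "j \<ge> 1" for j
    using indep that unfolding indep_vars_def by auto
  have D: "prob_space D"
    using prob_space_distr[OF X, of 1] ident[of 1] by simp
  have sets_D [measurable_cong]: "sets D = sets N"
    using ident[of 1, symmetric] by simp
  have meas_f [measurable]: "f \<in> borel_measurable D" using f by simp
  let ?\<xi> = "\<lambda>\<omega>. \<lambda>j\<in>{1..}. X j \<omega>"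
  have law: "distr M (Pi\<^sub>M {1..} (\<lambda>_. N)) ?\<xi> = Pi\<^sub>M {1..} (\<lambda>_. D)"
    using indep_vars_iff_distr_eq_PiM'[THEN iffD1, OF _ _ indep] X ident
    by (auto intro!: PiM_cong)
  have \<xi> [measurable]: "random_variable (Pi\<^sub>M {1..} (\<lambda>_. N)) ?\<xi>" by measurable
  have shift_law: "distr (Pi\<^sub>M {1..} (\<lambda>_. D)) (Pi\<^sub>M UNIV (\<lambda>_. D)) (\<lambda>x. \<lambda>i\<in>UNIV. x (Suc i)) = Pi\<^sub>M UNIV (\<lambda>_. D)"
    using D by (intro distr_PiM_reindex) auto
  have shift: "(\<lambda>x. \<lambda>i\<in>UNIV. x (Suc i)) \<in> Pi\<^sub>M {1..} (\<lambda>_. N) \<rightarrow>\<^sub>M Pi\<^sub>M UNIV (\<lambda>_. D)"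
    by (intro measurable_restrict measurable_compose[OF measurable_component_singleton]) (auto simp: sets_D cong: measurable_cong_sets)
  have "AE x in Pi\<^sub>M UNIV (\<lambda>_. D). (\<lambda>n. (\<Sum>i<n. f (x i)) / real n) \<longlonglongrightarrow> (\<integral>s. f s \<partial>D)"
    by (rule strong_law_of_large_numbers[OF D f])
  then have "AE x in distr (distr M (Pi\<^sub>M {1..} (\<lambda>_. N)) ?\<xi>) (Pi\<^sub>M UNIV (\<lambda>_. D)) (\<lambda>x. \<lambda>i\<in>UNIV. x (Suc i)).
      (\<lambda>n. (\<Sum>i<n. f (x i)) / real n) \<longlonglongrightarrow> (\<integral>s. f s \<partial>D)"
    unfolding law shift_law .
  then have "AE \<omega> in M. (\<lambda>n. (\<Sum>i<n. f (?\<xi> \<omega> (Suc i))) / real n) \<longlonglongrightarrow> (\<integral>s. f s \<partial>D)"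
    unfolding distr_distr[OF shift \<xi>]
    by (subst (asm) AE_distr_iff) (use measurable_comp[OF \<xi> shift] in \<open>auto simp: comp_def\<close>)
  then show ?thesis
  proof eventually_elim
    case (elim \<omega>)
    have "(\<Sum>i<n. f (?\<xi> \<omega> (Suc i))) = (\<Sum>j=1..n. f (X j \<omega>))" for n
      by (simp add: sum.atLeast1_atMost_eq)
    with elim show ?case by (simp del: One_nat_def)
  qed
qed

text \<open>
  Observations \<open>X\<^sub>1, X\<^sub>2, \<dots>\<close> with values in an arbitrary space, and a resample of size \<open>m n\<close>
  of the first \<open>n\<close> of them, recorded by the multiplicities \<open>W n j\<close>.
\<close>

locale bootstrap_sample = prob_space M
  for M :: "'w measure" +
  fixes N :: "'b measure"
    and X :: "nat \<Rightarrow> 'w \<Rightarrow> 'b"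
    and m :: "nat \<Rightarrow> nat"
    and W :: "nat \<Rightarrow> nat \<Rightarrow> 'w \<Rightarrow> nat"
    and \<delta> :: real
  assumes indep_X: "indep_vars (\<lambda>_. N) X {1..}"
    and ident_X: "\<And>j. j \<ge> 1 \<Longrightarrow> distr M N (X j) = distr M N (X 1)"
    and m_pos: "\<And>n. n \<ge> 1 \<Longrightarrow> m n > 0"
    and law_W: "\<And>n. n \<ge> 1 \<Longrightarrow>
           distr M (Pi\<^sub>M {1..n} (\<lambda>_. count_space UNIV)) (\<lambda>\<omega>. \<lambda>j\<in>{1..n}. W n j \<omega>)
             = multinomial (m n) {1..n} (pmf_of_set {1..n})"
    and indep_X_W: "indep_var2
           (Pi\<^sub>M {1..} (\<lambda>_. N)) (\<lambda>\<omega>. \<lambda>j\<in>{1..}. X j \<omega>)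
           (Pi\<^sub>M {1..} (\<lambda>n. Pi\<^sub>M {1..n} (\<lambda>_. count_space UNIV)))
           (\<lambda>\<omega>. \<lambda>n\<in>{1..}. \<lambda>j\<in>{1..n}. W n j \<omega>)"
    and \<delta>: "0 \<le> \<delta>" "\<delta> < 1"
    and rate: "(\<lambda>n. real n powr (1 - \<delta>) * ln (real n) / real (m n)) \<longlonglongrightarrow> 0"
begin

definition P :: "'b measure" where "P = distr M N (X 1)"

lemma sets_P [simp, measurable_cong]: "sets P = sets N"
  by (simp add: P_def)

lemma distr_X: "j \<ge> 1 \<Longrightarrow> distr M N (X j) = P"
  unfolding P_def by (rule ident_X)

lemma measurable_X [measurable]: "j \<ge> 1 \<Longrightarrow> random_variable N (X j)"
  using indep_X unfolding indep_vars_def by auto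

sublocale P: prob_space P
  unfolding P_def by (rule prob_space_distr) simp

abbreviation p :: real where "p \<equiv> 1 / (1 - \<delta>)"

lemma p_ge_1: "1 \<le> p"
  using \<delta> by simp

lemma integrable_if_integrable_powr:
  assumes [measurable]: "f \<in> borel_measurable N" and "integrable P (\<lambda>x. \<bar>f x\<bar> powr p)"
  shows "integrable P f"
proof (rule Bochner_Integration.integrable_bound)
  show "integrable P (\<lambda>x. 1 + \<bar>f x\<bar> powr p)" using assms by simp
  show "AE x in P. norm (f x) \<le> norm (1 + \<bar>f x\<bar> powr p)"
    using abs_le_one_plus_powr[OF p_ge_1] by (intro AE_I2) (simp add: abs_of_nonneg add_nonneg_nonneg)
qed simp

definition resampled_mean :: "nat \<Rightarrow> ('b \<Rightarrow> real) \<Rightarrow> 'w \<Rightarrow> real" where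
  "resampled_mean n f \<omega> = 1 / real (m n) * (\<Sum>j=1..n. real (W n j \<omega>) * f (X j \<omega>))"

text \<open>
  By the strong law for \<open>f\<close> and for \<open>\<bar>f\<bar> powr p\<close>, almost every sample \<open>x\<close> makes the fixed sequence
  \<open>f (x j)\<close> satisfy the hypotheses on \<open>z\<close> in \<open>multinomial_weighted_mean_tendsto\<close>; since \<open>X\<close> and \<open>W\<close> are
  independent, conditioning on the sample suffices.
\<close>

proposition resampled_mean_tendsto:
  assumes f [measurable]: "f \<in> borel_measurable N"
    and moment: "integrable P (\<lambda>x. \<bar>f x\<bar> powr p)"
  shows "AE \<omega> in M. (\<lambda>n. resampled_mean n f \<omega>) \<longlonglongrightarrow> (\<integral>x. f x \<partial>P)"
proof -
  let ?SX = "Pi\<^sub>M {1..} (\<lambda>_. N) :: (nat \<Rightarrow> 'b) measure"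
  let ?SW = "Pi\<^sub>M {1..} (\<lambda>n. Pi\<^sub>M {1..n} (\<lambda>_. count_space UNIV)) :: (nat \<Rightarrow> nat \<Rightarrow> nat) measure"
  let ?\<xi> = "\<lambda>\<omega>. \<lambda>j\<in>{1..}. X j \<omega>" and ?w = "\<lambda>\<omega>. \<lambda>n\<in>{1..}. \<lambda>j\<in>{1..n}. W n j \<omega>"
  let ?Q = "\<lambda>x w. (\<lambda>n. (\<Sum>j=1..n. real (w n j) * f (x j)) / real (m n)) \<longlonglongrightarrow> (\<integral>x. f x \<partial>P)"
  have \<xi> [measurable]: "random_variable ?SX ?\<xi>" and w [measurable]: "random_variable ?SW ?w"
    using indep_X_W unfolding indep_var2_def by auto
  have W_row: "random_variable (Pi\<^sub>M {1..n} (\<lambda>_. count_space UNIV)) (\<lambda>\<omega>. \<lambda>j\<in>{1..n}. W n j \<omega>)"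
    if "n \<ge> 1" for n
    using measurable_compose[OF w measurable_component_singleton, of n] that by simp
  let ?good = "\<lambda>x. (\<lambda>n. (\<Sum>j=1..n. f (x j)) / real n) \<longlonglongrightarrow> (\<integral>x. f x \<partial>P) \<and>
      (\<lambda>n. (\<Sum>j=1..n. \<bar>f (x j)\<bar> powr p) / real n) \<longlonglongrightarrow> (\<integral>x. \<bar>f x\<bar> powr p \<partial>P)"
  have mean_measurable: "(\<lambda>x. (\<Sum>j=1..n. g (x j)) / real n) \<in> borel_measurable ?SX"
    if "g \<in> borel_measurable N" for g :: "'b \<Rightarrow> real" and n
    using that by (intro borel_measurable_divide borel_measurable_sum
        measurable_compose[OF measurable_component_singleton]) auto
  have good_measurable: "{x \<in> space ?SX. ?good x} \<in> sets ?SX"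
    using mean_measurable[of f] mean_measurable[of "\<lambda>x. \<bar>f x\<bar> powr p"]
    by (intro sets.sets_Collect_conj predE measurable_limit) auto
  have "AE \<omega> in M. (\<lambda>n. (\<Sum>j=1..n. f (X j \<omega>)) / real n) \<longlonglongrightarrow> (\<integral>x. f x \<partial>P)"
    by (rule iid_mean_tendsto[OF indep_X distr_X integrable_if_integrable_powr[OF f moment]])
  moreover have "AE \<omega> in M. (\<lambda>n. (\<Sum>j=1..n. \<bar>f (X j \<omega>)\<bar> powr p) / real n) \<longlonglongrightarrow> (\<integral>x. \<bar>f x\<bar> powr p \<partial>P)"
    by (rule iid_mean_tendsto[OF indep_X distr_X moment])
  ultimately have "AE \<omega> in M. ?good (?\<xi> \<omega>)"
    by eventually_elim simp
  then have AE_good: "AE x in distr M ?SX ?\<xi>. ?good x"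
    by (rule AE_distr_iff[OF \<xi> good_measurable, THEN iffD2])
  have "AE \<omega> in M. ?Q (?\<xi> \<omega>) (?w \<omega>)"
  proof (rule AE_indep_var2I[OF indep_X_W])
    show "AE x in distr M ?SX ?\<xi>. AE \<omega> in M. ?Q x (?w \<omega>)"
      using AE_good
    proof eventually_elim
      case (elim x)
      have "Bseq (\<lambda>n. (\<Sum>j=1..n. \<bar>f (x j)\<bar> powr p) / real n)"
        using elim by (intro convergent_imp_Bseq convergentI) auto
      then obtain A where A: "\<And>n. (\<Sum>j=1..n. \<bar>f (x j)\<bar> powr p) / real n \<le> A"
        unfolding Bseq_def real_norm_def by (meson abs_le_D1)
      have "AE \<omega> in M. (\<lambda>n. (\<Sum>j=1..n. real (W n j \<omega>) * f (x j)) / real (m n)) \<longlonglongrightarrow> (\<integral>x. f x \<partial>P)"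
        by (rule multinomial_weighted_mean_tendsto[OF W_row law_W m_pos \<delta> rate elim[THEN conjunct1] A])
      then show ?case
      proof eventually_elim
        case (elim \<omega>)
        have "(\<Sum>j=1..n. real (?w \<omega> n j) * f (x j)) = (\<Sum>j=1..n. real (W n j \<omega>) * f (x j))" for n
          by (intro sum.cong) auto
        with elim show ?case by simp
      qed
    qed
    have entry: "(\<lambda>y. real (snd y n j) * f (fst y j)) \<in> borel_measurable (?SX \<Otimes>\<^sub>M ?SW)"
      if "j \<in> {1..n}" for n j
    proof -
      have "(\<lambda>w. w n) \<in> ?SW \<rightarrow>\<^sub>M Pi\<^sub>M {1..n} (\<lambda>_. count_space UNIV)"
        by (rule measurable_component_singleton) (use that in auto)
      moreover have "(\<lambda>c. c j) \<in> Pi\<^sub>M {1..n} (\<lambda>_. count_space UNIV) \<rightarrow>\<^sub>M (count_space UNIV :: nat measure)"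
        by (rule measurable_component_singleton) (use that in auto)
      ultimately have weight: "(\<lambda>y. snd y n j) \<in> ?SX \<Otimes>\<^sub>M ?SW \<rightarrow>\<^sub>M count_space UNIV"
        by (rule measurable_compose[OF measurable_compose[OF measurable_snd]])
      have "(\<lambda>x. x j) \<in> ?SX \<rightarrow>\<^sub>M N"
        by (rule measurable_component_singleton) (use that in auto)
      then have "(\<lambda>y. f (fst y j)) \<in> borel_measurable (?SX \<Otimes>\<^sub>M ?SW)"
        by (rule measurable_compose[OF measurable_compose[OF measurable_fst] f])
      with measurable_compose[OF weight, of real borel] show ?thesis
        by (intro borel_measurable_times) auto
    qed
    have "(\<lambda>y. (\<Sum>j=1..n. real (snd y n j) * f (fst y j)) / real (m n)) \<in> borel_measurable (?SX \<Otimes>\<^sub>M ?SW)" for n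
      by (intro borel_measurable_divide borel_measurable_sum entry) auto
    then show "Measurable.pred (?SX \<Otimes>\<^sub>M ?SW) (\<lambda>(x, w). ?Q x w)"
      by (simp add: split_beta')
  qed
  then show ?thesis
  proof eventually_elim
    case (elim \<omega>)
    have "(\<Sum>j=1..n. real (?w \<omega> n j) * f (?\<xi> \<omega> j)) = (\<Sum>j=1..n. real (W n j \<omega>) * f (X j \<omega>))" for n
      by (intro sum.cong) auto
    with elim show ?case by (simp add: resampled_mean_def)
  qed
qed

lemma resampled_mean_mono_dist:
  assumes "\<And>x. \<bar>f x - g x\<bar> \<le> h x"
  shows "\<bar>resampled_mean n f \<omega> - resampled_mean n g \<omega>\<bar> \<le> resampled_mean n h \<omega>"
proof -
  have "resampled_mean n f \<omega> - resampled_mean n g \<omega> = 1 / real (m n) * (\<Sum>j=1..n. real (W n j \<omega>) * (f (X j \<omega>) - g (X j \<omega>)))"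
    by (simp add: resampled_mean_def right_diff_distrib sum_subtractf diff_divide_distrib)
  also have "\<bar>\<dots>\<bar> \<le> 1 / real (m n) * (\<Sum>j=1..n. \<bar>real (W n j \<omega>) * (f (X j \<omega>) - g (X j \<omega>))\<bar>)"
    by (subst abs_mult) (intro mult_mono sum_abs, auto)
  also have "\<dots> \<le> resampled_mean n h \<omega>"
    unfolding resampled_mean_def abs_mult using assms
    by (auto intro!: mult_left_mono sum_mono divide_right_mono)
  finally show ?thesis .
qed

end

section \<open>Uniformity over a compact parameter set\<close>

text \<open>
  A supremum of \<open>H \<theta> x\<close> over an uncountable set of \<open>\<theta>\<close> need not be measurable in \<open>x\<close>. By continuity
  in \<open>\<theta>\<close>, a supremum over a countable dense subset can take its place.
\<close>

lemma compact_countable_dense_subset: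
  fixes \<Theta> :: "'t::metric_space set"
  assumes "compact \<Theta>"
  obtains D where "countable D" "D \<subseteq> \<Theta>" "\<Theta> \<subseteq> closure D"
proof -
  have "\<exists>F. finite F \<and> F \<subseteq> \<Theta> \<and> \<Theta> \<subseteq> (\<Union>x\<in>F. ball x (inverse (real (Suc k))))" for k
    by (rule compactE_image[OF assms, of \<Theta> "\<lambda>x. ball x (inverse (real (Suc k)))"]) auto
  then obtain F where F: "\<And>k. finite (F k)" "\<And>k. F k \<subseteq> \<Theta>"
      "\<And>k. \<Theta> \<subseteq> (\<Union>x\<in>F k. ball x (inverse (real (Suc k))))"
    by metis
  show thesis
  proof
    show "countable (\<Union>k. F k)" using F(1) by (auto intro: countable_finite)
    show "(\<Union>k. F k) \<subseteq> \<Theta>" using F(2) by auto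
    show "\<Theta> \<subseteq> closure (\<Union>k. F k)"
    proof
      fix \<theta> assume "\<theta> \<in> \<Theta>"
      show "\<theta> \<in> closure (\<Union>k. F k)"
        unfolding closure_approachable
      proof (intro allI impI)
        fix e :: real assume "e > 0"
        then obtain k where "inverse (real (Suc k)) < e" using reals_Archimedean by blast
        moreover obtain x where "x \<in> F k" "dist x \<theta> < inverse (real (Suc k))"
          using F(3)[of k] \<open>\<theta> \<in> \<Theta>\<close> by auto
        ultimately show "\<exists>y\<in>\<Union>k. F k. dist y \<theta> < e" by force
      qed
    qed
  qed
qed

context
  fixes \<Theta> D :: "'t::metric_space set"
  assumes compact: "compact \<Theta>" and D: "countable D" "D \<subseteq> \<Theta>" "\<Theta> \<subseteq> closure D"
begin

lemma bdd_above_image_subset: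
  fixes g :: "'t \<Rightarrow> real"
  assumes "continuous_on \<Theta> g" "A \<subseteq> \<Theta>"
  shows "bdd_above (g ` A)"
  using compact_imp_bounded[OF compact_continuous_image[OF assms(1) compact]] assms(2)
  by (meson bdd_above_mono bounded_imp_bdd_above image_mono)

lemma le_SUP_dense_subset:
  fixes g :: "'t \<Rightarrow> real"
  assumes g: "continuous_on \<Theta> g" and U: "open U" and \<theta>: "\<theta> \<in> \<Theta>" "\<theta> \<in> U"
  shows "g \<theta> \<le> (SUP \<eta>\<in>D \<inter> U. g \<eta>)"
proof (rule continuous_le_on_closure[where S = "D \<inter> U"])
  have "closure (D \<inter> U) \<subseteq> \<Theta>"
    using D(2) compact by (intro closure_minimal compact_imp_closed) auto
  then show "continuous_on (closure (D \<inter> U)) g"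
    by (rule continuous_on_subset[OF g])
  show "\<theta> \<in> closure (D \<inter> U)"
    using open_Int_closure_subset[OF U, of D] \<theta> D(3) by (auto simp: Int_commute)
  show "g \<eta> \<le> (SUP \<eta>\<in>D \<inter> U. g \<eta>)" if "\<eta> \<in> D \<inter> U" for \<eta>
    using that D(2) by (intro cSUP_upper bdd_above_image_subset g) auto
qed

lemma dense_subset_nonempty:
  assumes "open U" "\<theta> \<in> \<Theta>" "\<theta> \<in> U"
  shows "D \<inter> U \<noteq> {}"
  using assms D(3) by (meson disjoint_iff in_mono open_Int_closure_eq_empty)

end

context bootstrap_sample
begin

text \<open>
  Let \<open>osc \<theta> r x\<close> be the oscillation of \<open>H _ x\<close> around \<open>\<theta>\<close> at radius \<open>r\<close>. It tends to \<open>0\<close> with \<open>r\<close> and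
  is dominated by twice the envelope \<open>Y = sup \<bar>H\<bar>\<close>, so its mean becomes small too. By compactness
  finitely many balls \<open>ball \<eta> (r \<eta>)\<close> with small mean oscillation cover \<open>\<Theta>\<close>. For \<open>\<theta>\<close> in such a ball,
  replacing \<open>H \<theta>\<close> by \<open>H \<eta>\<close> changes the resampled mean by at most the resampled mean of the
  oscillation, and the expectation by at most its expectation. So it is enough that
  the resampled means converge for the finitely many functions \<open>H \<eta>\<close> and \<open>osc \<eta> (r \<eta>)\<close>, all of
  which have a finite moment of order \<open>p\<close>.
\<close>

lemma resampled_mean_close_uniformly:
  fixes H :: "'t::metric_space \<Rightarrow> 'b \<Rightarrow> real" and \<Theta> :: "'t set"
  assumes compact: "compact \<Theta>"
    and cont: "\<And>x. continuous_on \<Theta> (\<lambda>\<theta>. H \<theta> x)"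
    and H_measurable: "\<And>\<theta>. \<theta> \<in> \<Theta> \<Longrightarrow> H \<theta> \<in> borel_measurable N"
    and moment: "(\<integral>\<^sup>+ \<omega>. (\<Squnion>\<theta>\<in>\<Theta>. ennreal (\<bar>H \<theta> (X 1 \<omega>)\<bar> powr p)) \<partial>M) < \<infinity>"
    and "e > 0"
  shows "AE \<omega> in M. eventually (\<lambda>n. \<forall>\<theta>\<in>\<Theta>. \<bar>resampled_mean n (H \<theta>) \<omega> - (\<integral>x. H \<theta> x \<partial>P)\<bar> \<le> e) sequentially"
proof (cases "\<Theta> = {}")
  case False
  obtain D where D: "countable D" "D \<subseteq> \<Theta>" "\<Theta> \<subseteq> closure D"
    by (rule compact_countable_dense_subset[OF compact])
  note dense = compact D
  define Y where "Y x = (SUP \<theta>\<in>D \<inter> UNIV. \<bar>H \<theta> x\<bar>)" for x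
  define osc where "osc \<theta> r x = (SUP \<eta>\<in>D \<inter> ball \<theta> r. \<bar>H \<eta> x - H \<theta> x\<bar>)" for \<theta> r x
  have D_nonempty: "D \<noteq> {}" using D(3) False by auto
  have cont_abs: "continuous_on \<Theta> (\<lambda>\<theta>. \<bar>H \<theta> x\<bar>)" for x
    by (intro continuous_intros cont)
  have cont_dist: "continuous_on \<Theta> (\<lambda>\<eta>. \<bar>H \<eta> x - H \<theta> x\<bar>)" for \<theta> x
    by (intro continuous_intros cont)
  have H_le_Y: "\<bar>H \<theta> x\<bar> \<le> Y x" if "\<theta> \<in> \<Theta>" for \<theta> x
    unfolding Y_def by (rule le_SUP_dense_subset[OF dense cont_abs]) (use that in auto)
  have Y_nonneg: "0 \<le> Y x" for x
    using H_le_Y False by (metis abs_ge_zero ex_in_conv order_trans)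
  have osc_upper: "\<bar>H \<eta> x - H \<theta> x\<bar> \<le> osc \<theta> r x" if "\<eta> \<in> \<Theta>" "\<eta> \<in> ball \<theta> r" for \<eta> \<theta> r x
    unfolding osc_def by (rule le_SUP_dense_subset[OF dense cont_dist]) (use that in auto)
  have osc_least: "osc \<theta> r x \<le> c"
    if "\<theta> \<in> \<Theta>" "r > 0" "\<And>\<eta>. \<eta> \<in> \<Theta> \<Longrightarrow> dist \<theta> \<eta> < r \<Longrightarrow> \<bar>H \<eta> x - H \<theta> x\<bar> \<le> c" for \<theta> r x c
    unfolding osc_def using that D(2) dense_subset_nonempty[OF dense, of "ball \<theta> r" \<theta>]
    by (intro cSUP_least) auto
  have osc_nonneg: "0 \<le> osc \<theta> r x" if "\<theta> \<in> \<Theta>" "r > 0" for \<theta> r x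
    using osc_upper[of \<theta> \<theta> r x] that by simp
  have osc_le_Y: "osc \<theta> r x \<le> 2 * Y x" if "\<theta> \<in> \<Theta>" "r > 0" for \<theta> r x
    using H_le_Y[of _ x] H_le_Y[OF that(1), of x] by (intro osc_least[OF that]) force
  have Y_measurable [measurable]: "Y \<in> borel_measurable N"
    unfolding Y_def using D(1,2) H_measurable
    by (intro borel_measurable_cSUP bdd_above_image_subset[OF dense cont_abs]) auto
  have osc_measurable [measurable]: "osc \<theta> r \<in> borel_measurable N" if "\<theta> \<in> \<Theta>" for \<theta> r
  proof -
    have "osc \<theta> r = (\<lambda>x. SUP \<eta>\<in>D \<inter> ball \<theta> r. \<bar>H \<eta> x - H \<theta> x\<bar>)" by (simp add: osc_def fun_eq_iff)
    also have "\<dots> \<in> borel_measurable N"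
      using D(1,2) H_measurable that
      by (intro borel_measurable_cSUP bdd_above_image_subset[OF dense cont_dist]
          borel_measurable_abs borel_measurable_diff) auto
    finally show ?thesis .
  qed
  \<comment> \<open>Relates the moment of \<open>Y\<close> to the assumed one: at each \<open>x\<close>, some \<open>\<theta>\<close> attains the maximum.\<close>
  have Y_attained: "\<exists>\<theta>\<in>\<Theta>. Y x \<le> \<bar>H \<theta> x\<bar>" for x
  proof -
    obtain \<theta> where "\<theta> \<in> \<Theta>" "\<And>\<eta>. \<eta> \<in> \<Theta> \<Longrightarrow> \<bar>H \<eta> x\<bar> \<le> \<bar>H \<theta> x\<bar>"
      using continuous_attains_sup[OF compact False cont_abs] by blast
    then show ?thesis
      unfolding Y_def using D_nonempty D(2) by (intro bexI[of _ \<theta>] cSUP_least) auto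
  qed
  have Y_powr: "integrable P (\<lambda>x. Y x powr p)"
  proof (rule integrableI_nonneg)
    have "ennreal (Y x powr p) \<le> (\<Squnion>\<theta>\<in>\<Theta>. ennreal (\<bar>H \<theta> x\<bar> powr p))" for x
    proof -
      obtain \<theta> where "\<theta> \<in> \<Theta>" "Y x \<le> \<bar>H \<theta> x\<bar>" using Y_attained by blast
      then show ?thesis
        using Y_nonneg \<delta> by (intro SUP_upper2[of \<theta>] ennreal_leI powr_mono2) auto
    qed
    then have "(\<integral>\<^sup>+ \<omega>. ennreal (Y (X 1 \<omega>) powr p) \<partial>M) \<le> (\<integral>\<^sup>+ \<omega>. (\<Squnion>\<theta>\<in>\<Theta>. ennreal (\<bar>H \<theta> (X 1 \<omega>)\<bar> powr p)) \<partial>M)"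
      by (intro nn_integral_mono)
    also have "(\<integral>\<^sup>+ \<omega>. ennreal (Y (X 1 \<omega>) powr p) \<partial>M) = (\<integral>\<^sup>+ x. ennreal (Y x powr p) \<partial>P)"
      unfolding P_def by (rule nn_integral_distr[symmetric]) auto
    finally show "(\<integral>\<^sup>+ x. ennreal (Y x powr p) \<partial>P) < \<infinity>" using moment by (rule le_less_trans)
  qed auto
  have dominated: "integrable P (\<lambda>x. \<bar>f x\<bar> powr p)"
    if [measurable]: "f \<in> borel_measurable N" and f: "\<And>x. \<bar>f x\<bar> \<le> 2 * Y x" for f
  proof (rule Bochner_Integration.integrable_bound)
    show "integrable P (\<lambda>x. 2 powr p * Y x powr p)" using Y_powr by simp
    have "\<bar>f x\<bar> powr p \<le> (2 * Y x) powr p" for x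
      using f \<delta> by (intro powr_mono2) auto
    then show "AE x in P. norm (\<bar>f x\<bar> powr p) \<le> norm (2 powr p * Y x powr p)"
      using Y_nonneg by (intro AE_I2) (simp add: powr_mult)
  qed measurable
  have H_powr: "integrable P (\<lambda>x. \<bar>H \<theta> x\<bar> powr p)" if "\<theta> \<in> \<Theta>" for \<theta>
  proof (rule dominated[OF H_measurable[OF that]])
    show "\<bar>H \<theta> x\<bar> \<le> 2 * Y x" for x using H_le_Y[OF that, of x] Y_nonneg[of x] by linarith
  qed
  have osc_powr: "integrable P (\<lambda>x. \<bar>osc \<theta> r x\<bar> powr p)" if "\<theta> \<in> \<Theta>" "r > 0" for \<theta> r
    by (rule dominated[OF osc_measurable[OF that(1)]]) (use osc_le_Y[OF that] osc_nonneg[OF that] in simp)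
  note H_int = integrable_if_integrable_powr[OF H_measurable H_powr]
  note osc_int = integrable_if_integrable_powr[OF osc_measurable osc_powr]
  have Y_int: "integrable P Y"
    by (rule integrable_if_integrable_powr[OF Y_measurable]) (use Y_powr Y_nonneg in simp)
  \<comment> \<open>A quarter for each error: the resampled mean of \<open>H \<eta>\<close>, the oscillation of the
    expectation, and twice that for the resampled oscillation.\<close>
  define \<epsilon> where "\<epsilon> = e / 4"
  have "\<epsilon> > 0" using \<open>e > 0\<close> by (simp add: \<epsilon>_def)
  have small_osc: "\<exists>r>0. (\<integral>x. osc \<theta> r x \<partial>P) < \<epsilon>" if \<theta>: "\<theta> \<in> \<Theta>" for \<theta>
  proof -
    let ?r = "\<lambda>k. inverse (real (Suc k))"
    have "(\<lambda>k. \<integral>x. osc \<theta> (?r k) x \<partial>P) \<longlonglongrightarrow> (\<integral>x. 0 \<partial>P)"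
    proof (rule integral_dominated_convergence[where w = "\<lambda>x. 2 * Y x"])
      show "AE x in P. (\<lambda>k. osc \<theta> (?r k) x) \<longlonglongrightarrow> 0"
      proof (rule AE_I2, rule tendstoI)
        fix x and e' :: real assume "e' > 0"
        then obtain d where d: "d > 0" "\<And>\<eta>. \<eta> \<in> \<Theta> \<Longrightarrow> dist \<eta> \<theta> < d \<Longrightarrow> dist (H \<eta> x) (H \<theta> x) < e' / 2"
          using cont[of x] \<theta> unfolding continuous_on_iff by (meson half_gt_zero)
        have "eventually (\<lambda>k. ?r k < d) sequentially"
          using LIMSEQ_inverse_real_of_nat d(1) by (rule order_tendstoD)
        then show "eventually (\<lambda>k. dist (osc \<theta> (?r k) x) 0 < e') sequentially"
        proof eventually_elim
          case (elim k)
          have "osc \<theta> (?r k) x \<le> e' / 2"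
            using d(2) elim by (intro osc_least \<theta>) (auto simp: dist_real_def dist_commute intro!: less_imp_le)
          then show ?case using osc_nonneg[OF \<theta>, of "?r k" x] \<open>e' > 0\<close> by simp
        qed
      qed
      show "AE x in P. norm (osc \<theta> (?r k) x) \<le> 2 * Y x" for k
        using osc_le_Y[OF \<theta>, of "?r k"] osc_nonneg[OF \<theta>, of "?r k"] by (intro AE_I2) simp
    qed (use Y_int osc_measurable[OF \<theta>] in simp_all)
    then have "eventually (\<lambda>k. (\<integral>x. osc \<theta> (?r k) x \<partial>P) < \<epsilon>) sequentially"
      using \<open>\<epsilon> > 0\<close> by (intro order_tendstoD(2)) auto
    then obtain k where "(\<integral>x. osc \<theta> (?r k) x \<partial>P) < \<epsilon>"
      by (auto simp: eventually_sequentially)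
    then show ?thesis by (intro exI[of _ "?r k"]) simp
  qed
  then obtain r where r: "\<And>\<theta>. \<theta> \<in> \<Theta> \<Longrightarrow> r \<theta> > 0"
      "\<And>\<theta>. \<theta> \<in> \<Theta> \<Longrightarrow> (\<integral>x. osc \<theta> (r \<theta>) x \<partial>P) < \<epsilon>"
    by metis
  obtain F where F: "F \<subseteq> \<Theta>" "finite F" "\<Theta> \<subseteq> (\<Union>\<eta>\<in>F. ball \<eta> (r \<eta>))"
    by (rule compactE_image[OF compact, of \<Theta> "\<lambda>\<eta>. ball \<eta> (r \<eta>)"]) (use r(1) in force)+
  have "AE \<omega> in M. \<forall>\<eta>\<in>F. (\<lambda>n. resampled_mean n (H \<eta>) \<omega>) \<longlonglongrightarrow> (\<integral>x. H \<eta> x \<partial>P)"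
    using F by (intro AE_finite_allI resampled_mean_tendsto H_measurable H_powr) auto
  moreover have "AE \<omega> in M. \<forall>\<eta>\<in>F. (\<lambda>n. resampled_mean n (osc \<eta> (r \<eta>)) \<omega>) \<longlonglongrightarrow> (\<integral>x. osc \<eta> (r \<eta>) x \<partial>P)"
    using F r(1) by (intro AE_finite_allI resampled_mean_tendsto osc_measurable osc_powr) auto
  ultimately show ?thesis
  proof eventually_elim
    case (elim \<omega>)
    have "eventually (\<lambda>n. \<forall>\<eta>\<in>F. \<bar>resampled_mean n (H \<eta>) \<omega> - (\<integral>x. H \<eta> x \<partial>P)\<bar> < \<epsilon> \<and>
        resampled_mean n (osc \<eta> (r \<eta>)) \<omega> < 2 * \<epsilon>) sequentially"
    proof (intro eventually_ball_finite F ballI eventually_conj)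
      fix \<eta> assume "\<eta> \<in> F"
      then show "eventually (\<lambda>n. \<bar>resampled_mean n (H \<eta>) \<omega> - (\<integral>x. H \<eta> x \<partial>P)\<bar> < \<epsilon>) sequentially"
        using tendstoD[OF elim(1)[rule_format] \<open>\<epsilon> > 0\<close>] by (simp add: dist_real_def)
      show "eventually (\<lambda>n. resampled_mean n (osc \<eta> (r \<eta>)) \<omega> < 2 * \<epsilon>) sequentially"
        using elim(2)[rule_format, OF \<open>\<eta> \<in> F\<close>] r(2)[of \<eta>] \<open>\<eta> \<in> F\<close> F(1) \<open>\<epsilon> > 0\<close>
        by (intro order_tendstoD(2)) auto
    qed
    then show ?case
    proof eventually_elim
      case (elim n)
      show ?case
      proof
        fix \<theta> assume \<theta>: "\<theta> \<in> \<Theta>"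
        then obtain \<eta> where \<eta>: "\<eta> \<in> F" "\<theta> \<in> ball \<eta> (r \<eta>)" "\<eta> \<in> \<Theta>" using F by blast
        note dist_le = osc_upper[OF \<theta> \<eta>(2)]
        have "\<bar>resampled_mean n (H \<theta>) \<omega> - resampled_mean n (H \<eta>) \<omega>\<bar> \<le> resampled_mean n (osc \<eta> (r \<eta>)) \<omega>"
          by (rule resampled_mean_mono_dist) (rule dist_le)
        moreover have "\<bar>(\<integral>x. H \<theta> x \<partial>P) - (\<integral>x. H \<eta> x \<partial>P)\<bar> \<le> (\<integral>x. osc \<eta> (r \<eta>) x \<partial>P)"
        proof -
          have "\<bar>(\<integral>x. H \<theta> x \<partial>P) - (\<integral>x. H \<eta> x \<partial>P)\<bar> = \<bar>\<integral>x. H \<theta> x - H \<eta> x \<partial>P\<bar>"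
            using H_int[OF \<theta> \<theta>] H_int[OF \<eta>(3) \<eta>(3)] by simp
          also have "\<dots> \<le> (\<integral>x. \<bar>H \<theta> x - H \<eta> x\<bar> \<partial>P)"
            by (rule integral_abs_bound)
          also have "\<dots> \<le> (\<integral>x. osc \<eta> (r \<eta>) x \<partial>P)"
            using H_int[OF \<theta> \<theta>] H_int[OF \<eta>(3) \<eta>(3)] osc_int[OF \<eta>(3) \<eta>(3) r(1)[OF \<eta>(3)]]
            by (intro integral_mono dist_le) auto
          finally show ?thesis .
        qed
        ultimately show "\<bar>resampled_mean n (H \<theta>) \<omega> - (\<integral>x. H \<theta> x \<partial>P)\<bar> \<le> e"
          using elim[rule_format, OF \<eta>(1)] r(2)[OF \<eta>(3)] unfolding \<epsilon>_def by linarith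
      qed
    qed
  qed
qed simp

end

theorem theorem1:
  fixes M :: "'w measure"
    and \<Theta> :: "'t :: metric_space set"
    and H :: "'t \<Rightarrow> real ^ 'u \<Rightarrow> real"
    and X :: "nat \<Rightarrow> 'w \<Rightarrow> real ^ 'u"
    and m :: "nat \<Rightarrow> nat"
    and W :: "nat \<Rightarrow> nat \<Rightarrow> 'w \<Rightarrow> nat"
    and \<delta> :: real
  assumes "prob_space M"
    and "separable_space (euclidean :: 't topology)"
    and "compact \<Theta>"
    and "\<And>x. continuous_on \<Theta> (\<lambda>\<theta>. H \<theta> x)"
    and "\<And>\<theta>. \<theta> \<in> \<Theta> \<Longrightarrow> H \<theta> \<in> borel_measurable borel"
    and "prob_space.indep_vars M (\<lambda>_. borel) X {1..}"
    and "\<And>j. j \<ge> 1 \<Longrightarrow> distr M borel (X j) = distr M borel (X 1)"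
    and "\<And>n. n \<ge> 1 \<Longrightarrow> m n > 0"
    and "\<And>n. n \<ge> 1 \<Longrightarrow>
           distr M (Pi\<^sub>M {1..n} (\<lambda>_. count_space UNIV)) (\<lambda>\<omega>. \<lambda>j\<in>{1..n}. W n j \<omega>)
             = multinomial (m n) {1..n} (pmf_of_set {1..n})"
    and "prob_space.indep_vars M (\<lambda>n. Pi\<^sub>M {1..n} (\<lambda>_. count_space UNIV))
           (\<lambda>n \<omega>. \<lambda>j\<in>{1..n}. W n j \<omega>) {1..}"
    and "prob_space.indep_var2 M
           (Pi\<^sub>M {1..} (\<lambda>_. borel)) (\<lambda>\<omega>. \<lambda>j\<in>{1..}. X j \<omega>)
           (Pi\<^sub>M {1..} (\<lambda>n. Pi\<^sub>M {1..n} (\<lambda>_. count_space UNIV)))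
           (\<lambda>\<omega>. \<lambda>n\<in>{1..}. \<lambda>j\<in>{1..n}. W n j \<omega>)"
    and "0 \<le> \<delta>" and "\<delta> < 1"
    and "(\<lambda>n. real n powr (1 - \<delta>) * ln (real n) / real (m n)) \<longlonglongrightarrow> 0"
    and "(\<integral>\<^sup>+ \<omega>. (\<Squnion>\<theta>\<in>\<Theta>. ennreal (\<bar>H \<theta> (X 1 \<omega>)\<bar> powr (1 / (1 - \<delta>)))) \<partial>M) < \<infinity>"
  shows "AE \<omega> in M. (\<lambda>n. \<Squnion>\<theta>\<in>\<Theta>. ennreal
           \<bar>1 / real (m n) * (\<Sum>j=1..n. real (W n j \<omega>) * H \<theta> (X j \<omega>))
              - (\<integral>\<omega>'. H \<theta> (X 1 \<omega>') \<partial>M)\<bar>) \<longlonglongrightarrow> 0"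
proof -
  interpret bootstrap_sample M borel X m W \<delta>
    by (intro bootstrap_sample.intro bootstrap_sample_axioms.intro assms)
  have mean: "(\<integral>\<omega>'. H \<theta> (X 1 \<omega>') \<partial>M) = (\<integral>x. H \<theta> x \<partial>P)" if "\<theta> \<in> \<Theta>" for \<theta>
    unfolding P_def using assms(5)[OF that] by (intro integral_distr[symmetric]) auto
  have "AE \<omega> in M. \<forall>k. eventually (\<lambda>n. \<forall>\<theta>\<in>\<Theta>.
      \<bar>resampled_mean n (H \<theta>) \<omega> - (\<integral>x. H \<theta> x \<partial>P)\<bar> \<le> inverse (real (Suc k))) sequentially"
    unfolding AE_all_countable
    by (intro allI resampled_mean_close_uniformly assms(3-5,15)) auto
  then show ?thesis
  proof eventually_elim
    case (elim \<omega>)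
    let ?d = "\<lambda>n. \<Squnion>\<theta>\<in>\<Theta>. ennreal \<bar>1 / real (m n) * (\<Sum>j=1..n. real (W n j \<omega>) * H \<theta> (X j \<omega>))
              - (\<integral>\<omega>'. H \<theta> (X 1 \<omega>') \<partial>M)\<bar>"
    show "?d \<longlonglongrightarrow> 0"
    proof (rule order_tendstoI)
      fix a :: ennreal assume "0 < a"
      then obtain b :: real where b: "0 < b" "ennreal b < a"
      proof -
        obtain c where c: "0 < c" "c < a" using dense \<open>0 < a\<close> by blast
        then have "c \<noteq> \<top>" by (auto simp: top_unique not_less[symmetric])
        then obtain b where "c = ennreal b" "0 \<le> b" by (cases c) auto
        then show ?thesis using c that[of b] by (cases "b = 0") auto
      qed
      obtain k where k: "inverse (real (Suc k)) < b" using reals_Archimedean b(1) by blast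
      from elim[rule_format, of k] show "eventually (\<lambda>n. ?d n < a) sequentially"
      proof eventually_elim
        case (elim n)
        have "?d n \<le> ennreal (inverse (real (Suc k)))"
          using elim by (intro SUP_least ennreal_leI) (simp add: resampled_mean_def mean del: One_nat_def)
        also have "\<dots> \<le> ennreal b" using k by (intro ennreal_leI) simp
        finally show ?case using b(2) by (rule le_less_trans)
      qed
    qed simp
  qed
qed

end
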